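(* Let $d \ge 1$ and $j$ be integers with $d/2 < j \le d$. Then the smallest eigenvalue of $J(2d,d,j)$, and the second largest in absolute value, is $E_j(1)$; that is, $E_j(1)\le E_j(i)$ for all $0\le i\le d$ and $|E_j(i)|\le |E_j(1)|$ for all $1\le i\le d$.
   Context: $J(2d,d,j)$ is the graph whose vertices are the $d$-subsets of a fixed $2d$-set, two vertices being adjacent when they meet in exactly $d-j$ elements. Its eigenvalues are the numbers (with $n=2d$) $$E_j(i) = \sum_{h=0}^j (-1)^h \binom{i}{h} \binom{d-i}{j-h} \binom{n-d-i}{j-h},\qquad 0\le i\le d,$$ and $E_j(0)$ is the valency. *)

theory Defs
  imports
    "HOL-Library.Multiset"
    "Graph_Theory.Pair_Digraph"
    "Jordan_Normal_Form.Char_Poly"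
begin

text \<open>
  Undirected simple graphs are symmetric loop-free digraphs (locale \<^locale>\<open>pair_graph\<close>).
  The parameters \<open>n\<close> and \<open>d\<close> of \<open>J(n,d,j)\<close> are the size of the ground set \<open>X\<close> and the
  size of the vertices. The subtraction \<open>d - j\<close> is on \<open>nat\<close>, so \<open>j \<le> d\<close> is required for the
  intended meaning; the graph is loop-free only for \<open>j \<ge> 1\<close>.
\<close>

definition johnson_graph :: "'a set \<Rightarrow> nat \<Rightarrow> nat \<Rightarrow> 'a set pair_pre_digraph" where
  "johnson_graph X d j =
     \<lparr> pverts = {A. A \<subseteq> X \<and> card A = d},
       parcs = {(A, B). A \<subseteq> X \<and> card A = d \<and> B \<subseteq> X \<and> card B = d \<and> card (A \<inter> B) = d - j} \<rparr>"

lemma pair_graph_johnson_graph: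
  assumes "finite X" "1 \<le> j" "j \<le> d"
  shows "pair_graph (johnson_graph X d j)"
proof -
  let ?G = "johnson_graph X d j"
  have sub: "pverts ?G \<subseteq> Pow X" "parcs ?G \<subseteq> Pow X \<times> Pow X"
    unfolding johnson_graph_def by auto
  have fin: "finite (pverts ?G)" "finite (parcs ?G)"
    using finite_subset[OF sub(1)] finite_subset[OF sub(2)] assms(1) by simp_all
  have wf: "fst e \<in> pverts ?G" "snd e \<in> pverts ?G" if "e \<in> parcs ?G" for e
    using that unfolding johnson_graph_def by auto
  have loop: "fst e \<noteq> snd e" if "e \<in> parcs ?G" for e
  proof
    assume eq: "fst e = snd e"
    have c: "card (fst e) = d" "card (fst e \<inter> snd e) = d - j"
      using that unfolding johnson_graph_def by auto
    have "d = card (fst e \<inter> snd e)"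
      unfolding eq[symmetric] Int_absorb by (rule c(1)[symmetric])
    also note c(2)
    finally show False
      using assms(2,3) by linarith
  qed
  have "sym (parcs ?G)"
    by (rule symI) (auto simp: johnson_graph_def Int_commute)
  then have sym: "symmetric (with_proj ?G)"
    unfolding symmetric_def with_proj_simps .
  show ?thesis
    by unfold_locales (rule wf fin sym loop, assumption?)+
qed

text \<open>
  The adjacency matrix with respect to an enumeration \<open>vs\<close> of the vertices; its eigenvalues
  do not depend on the enumeration.
\<close>

definition adjacency_matrix :: "'v pair_pre_digraph \<Rightarrow> 'v list \<Rightarrow> real mat" where
  "adjacency_matrix G vs =
     mat (length vs) (length vs) (\<lambda>(r, c). if (vs ! r, vs ! c) \<in> parcs G then 1 else 0)"

text \<open>
  Eigenvalues repeated according to algebraic multiplicity. Only real roots are counted, which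
  loses nothing for symmetric matrices.
\<close>

definition spectrum_mset :: "real mat \<Rightarrow> real multiset" where
  "spectrum_mset A = proots (char_poly A)"

definition smallest_eigenvalue :: "real mat \<Rightarrow> real \<Rightarrow> bool" where
  "smallest_eigenvalue A x \<longleftrightarrow> eigenvalue A x \<and> (\<forall>y. eigenvalue A y \<longrightarrow> x \<le> y)"

text \<open>
  \<open>x\<close> can occupy the second place when the eigenvalues, with multiplicity, are listed by
  decreasing absolute value; the first place is taken by \<open>y\<close>. There may be ties.
\<close>

definition second_largest_abs_eigenvalue :: "real mat \<Rightarrow> real \<Rightarrow> bool" where
  "second_largest_abs_eigenvalue A x \<longleftrightarrow>
     (\<exists>y. y \<in># spectrum_mset A \<and> (\<forall>z. z \<in># spectrum_mset A \<longrightarrow> \<bar>z\<bar> \<le> \<bar>y\<bar>) \<and>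
          x \<in># spectrum_mset A - {#y#} \<and> (\<forall>z. z \<in># spectrum_mset A - {#y#} \<longrightarrow> \<bar>z\<bar> \<le> \<bar>x\<bar>))"

text \<open>
  The numbers \<open>E\<^sub>j(i)\<close> for \<open>J(n,d,j)\<close>. The natural-number subtractions are exact for
  \<open>i \<le> d\<close> and \<open>2 * d \<le> n\<close>.
\<close>

definition johnson_E :: "nat \<Rightarrow> nat \<Rightarrow> nat \<Rightarrow> nat \<Rightarrow> real" where
  "johnson_E n d j i =
     (\<Sum>h = 0..j. (-1) ^ h * real (i choose h) * real ((d - i) choose (j - h))
                    * real ((n - d - i) choose (j - h)))"

end

theory Submission
  imports Defs
begin

text \<open>
  Write \<open>e(m, i, j) = (\<Sum>h\<le>j. (-1)^h (i choose h) (m choose (j - h))\<^sup>2)\<close>, so that \<open>E\<^sub>j(i) = e(d - i, i, j)\<close>.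
  This is the coefficient of \<open>x^j\<close> in \<open>(1 - x)^i (\<Sum>t. (m choose t)\<^sup>2 x^t)\<close>, whence the recursion
  \<open>e(m, i + 1, j + 1) = e(m, i, j + 1) - e(m, i, j)\<close> and the symmetry \<open>e(m, i, m + i - j) = (-1)^i e(m, i, j)\<close>.
  The bound \<open>\<bar>e(m, i, j)\<bar> \<le> (d choose j)\<^sup>2 (2 j - d) / d\<close> for \<open>d = m + i < 2 j\<close>, \<open>i > 0\<close>, holds with equality
  at \<open>i = 1\<close> and propagates along the recursion.

  The eigenvalues are found with the vectors \<open>\<Prod>(x\<^sub>a - x\<^sub>b)\<close> over \<open>i\<close> disjoint pairs \<open>(a, b)\<close> of points.
  Peeling off a pair shows that such a vector is an eigenvector for \<open>E\<^sub>j(i)\<close>. A function orthogonal to all of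
  them vanishes: by induction on the size of the subsets it is invariant under exchanging two points,
  hence constant, and its sum is zero. So every eigenvector pairs nontrivially with one of these vectors,
  and every eigenvector of sum zero with one for \<open>i \<ge> 1\<close>.
\<close>

subsection \<open>Estimates for the Eberlein numbers\<close>

text \<open>\<open>m\<close> and \<open>i\<close> are independent parameters: the recursion lowers
  \<open>i\<close> at fixed \<open>m\<close>, so the underlying \<open>d = m + i\<close> drops with
  it.\<close>

definition eberlein :: "nat \<Rightarrow> nat \<Rightarrow> nat \<Rightarrow> real" where
  "eberlein m i j = (\<Sum>h\<le>j. (-1) ^ h * real (i choose h) * (real (m choose (j - h)))\<^sup>2)"

lemma johnson_E_eq_eberlein:
  assumes "i \<le> d"
  shows "johnson_E (2 * d) d j i = eberlein (d - i) i j"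
  by (simp add: johnson_E_def eberlein_def atLeast0AtMost power2_eq_square mult.assoc)

section \<open>Recursion, degree and symmetry of the coefficients\<close>

lemma eberlein_zero_left [simp]: "eberlein m 0 j = (real (m choose j))\<^sup>2"
proof -
  have "eberlein m 0 j = (\<Sum>h\<in>{0}. (-1) ^ h * real (0 choose h) * (real (m choose (j - h)))\<^sup>2)"
    unfolding eberlein_def by (rule sum.mono_neutral_right) (auto simp: binomial_eq_0)
  then show ?thesis by simp
qed

lemma eberlein_zero_right [simp]: "eberlein m i 0 = 1"
  by (simp add: eberlein_def)

lemma eberlein_Suc_Suc:
  "eberlein m (Suc i) (Suc j) = eberlein m i (Suc j) - eberlein m i j"
proof -
  let ?c = "\<lambda>t. (real (m choose t))\<^sup>2"
  have "eberlein m (Suc i) (Suc j)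
      = ?c (Suc j) + (\<Sum>h\<le>j. (-1) ^ Suc h * real (Suc i choose Suc h) * ?c (j - h))"
    unfolding eberlein_def by (subst sum.atMost_Suc_shift) simp
  also have "(\<Sum>h\<le>j. (-1) ^ Suc h * real (Suc i choose Suc h) * ?c (j - h))
      = (\<Sum>h\<le>j. (-1) ^ Suc h * real (i choose Suc h) * ?c (j - h)) - eberlein m i j"
    unfolding eberlein_def sum_subtractf[symmetric] by (rule sum.cong) (simp_all add: algebra_simps)
  also have "?c (Suc j) + \<dots> = eberlein m i (Suc j) - eberlein m i j"
    unfolding eberlein_def[of m i "Suc j"] by (subst sum.atMost_Suc_shift) simp
  finally show ?thesis .
qed

text \<open>The generating polynomial has degree \<open>m + i\<close>.\<close>

lemma eberlein_eq_0: "m + i < j \<Longrightarrow> eberlein m i j = 0"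
proof (induction i arbitrary: j)
  case (Suc i)
  then obtain j' where "j = Suc j'" by (cases j) auto
  with Suc show ?case by (simp add: eberlein_Suc_Suc)
qed (simp add: binomial_eq_0)

lemma eberlein_top: "eberlein m i (m + i) = (-1) ^ i"
  by (induction i) (simp_all add: eberlein_Suc_Suc eberlein_eq_0)

text \<open>Both factors of the generating polynomial are palindromic, the first up to the sign
  \<open>(-1) ^ i\<close>. In the induction, reflection exchanges the two terms of the recursion;
  the end coefficients come from \<open>eberlein_top\<close>.\<close>

lemma eberlein_symmetric: "j + j' = m + i \<Longrightarrow> eberlein m i j' = (-1) ^ i * eberlein m i j"
proof (induction i arbitrary: j j')
  case 0
  then show ?case using binomial_symmetric[of j m] by (auto simp: algebra_simps)
next
  case (Suc i)
  show ?case
  proof (cases "j = 0 \<or> j' = 0")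
    case True
    with Suc.prems eberlein_top[of m "Suc i"] show ?thesis
      by (auto simp flip: power_mult_distrib)
  next
    case False
    then obtain k k' where k: "j = Suc k" "j' = Suc k'"
      by (metis not0_implies_Suc)
    with Suc.prems have "Suc k + k' = m + i" "k + Suc k' = m + i" by simp_all
    from this[THEN Suc.IH] show ?thesis
      by (simp add: k eberlein_Suc_Suc algebra_simps)
  qed
qed


section \<open>The bound attained at \<open>i = 1\<close> and its growth in \<open>d\<close>\<close>

lemma Suc_times_choose_Suc: "real (Suc n) * real (n choose j) = real (Suc n choose Suc j) * (real j + 1)"
  using Suc_times_binomial_eq[of n j] by (metis of_nat_Suc of_nat_mult add.commute)

lemma Suc_times_choose: "real (Suc n) * real (n choose j) = real (Suc n choose j) * (real (Suc n) - real j)"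
proof (cases "j \<le> Suc n")
  case True
  have "(Suc n choose j) * (Suc n - j) = Suc n * (n choose j)"
    using binomial_absorb_comp[of "Suc n" j] by (simp add: mult.commute)
  then have "real (Suc n choose j) * real (Suc n - j) = real (Suc n) * real (n choose j)"
    by (metis of_nat_mult)
  then show ?thesis using True by (simp add: of_nat_diff)
qed (simp add: binomial_eq_0)

text \<open>The value of \<open>\<bar>E\<^sub>j(1)\<bar>\<close> when \<open>2 * j > d\<close>.\<close>

definition eberlein_bound :: "nat \<Rightarrow> nat \<Rightarrow> real" where
  "eberlein_bound d j = (real (d choose j))\<^sup>2 * (2 * real j - real d) / real d"

text \<open>Absorption writes both binomials in \<open>(m choose Suc j)^2 - (m choose j)^2\<close>
  as multiples of \<open>Suc m choose Suc j\<close>. The minus sign is what later makes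
  \<open>E_j(1)\<close> the smallest eigenvalue.\<close>

lemma eberlein_one: "eberlein m 1 (Suc j) = - eberlein_bound (Suc m) (Suc j)"
proof -
  define c where "c = real (Suc m choose Suc j)"
  define D where "D = real (Suc m)"
  have D: "D > 0" by (simp add: D_def)
  have a: "real (m choose j) = c * (real j + 1) / D"
    using Suc_times_choose_Suc[of m j] D by (simp add: c_def D_def field_simps)
  have b: "real (m choose Suc j) = c * (D - real j - 1) / D"
    using Suc_times_choose[of m "Suc j"] D by (simp add: c_def D_def field_simps)
  have "eberlein m 1 (Suc j) = (real (m choose Suc j))\<^sup>2 - (real (m choose j))\<^sup>2"
    by (simp add: eberlein_Suc_Suc)
  also have "\<dots> = - (c\<^sup>2 * (2 * real (Suc j) - D) / D)"
    unfolding a b using D by (simp add: field_simps power2_eq_square)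
  finally show ?thesis by (simp add: eberlein_bound_def c_def D_def)
qed

lemma eberlein_bound_nonneg: "d \<le> 2 * j \<Longrightarrow> 0 \<le> eberlein_bound d j"
  by (auto simp: eberlein_bound_def)

text \<open>Lets the bound pass through the triangle inequality in one recursion step. The
  difference of the sides factors; the factor \<open>2 * J - D\<close> is nonnegative by
  \<open>d < 2 * Suc j\<close>.\<close>

lemma eberlein_bound_add_le:
  assumes "0 < d" "d < 2 * Suc j"
  shows "eberlein_bound d (Suc j) + eberlein_bound d j \<le> eberlein_bound (Suc d) (Suc j)"
proof (cases "j \<le> d")
  case True
  define c where "c = real (Suc d choose Suc j)"
  define D where "D = real (Suc d)"
  define J where "J = real (Suc j)"
  have D: "D > 1" and J: "0 \<le> J" "J \<le> D" "D \<le> 2 * J"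
    using assms True by (simp_all add: D_def J_def)
  have a: "real (d choose j) = c * J / D"
    using Suc_times_choose_Suc[of d j] D by (simp add: c_def D_def J_def field_simps)
  have b: "real (d choose Suc j) = c * (D - J) / D"
    using Suc_times_choose[of d "Suc j"] D by (simp add: c_def D_def J_def field_simps)
  have d: "real d = D - 1" "real j = J - 1" by (simp_all add: D_def J_def)
  have "eberlein_bound (Suc d) (Suc j) - (eberlein_bound d (Suc j) + eberlein_bound d j)
      = c\<^sup>2 * (2 * J - D) / D - ((c * (D - J) / D)\<^sup>2 * (2 * J - D + 1) / (D - 1)
          + (c * J / D)\<^sup>2 * (2 * J - D - 1) / (D - 1))"
    unfolding eberlein_bound_def a b c_def[symmetric] D_def[symmetric] J_def[symmetric] d
    by (simp add: algebra_simps)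
  also have "\<dots> = 2 * c\<^sup>2 * J * (D - J) * (2 * J - D) / (D\<^sup>2 * (D - 1))"
    using D by (simp add: divide_simps) (simp add: algebra_simps power2_eq_square power3_eq_cube)
  also have "\<dots> \<ge> 0"
    using D J by simp
  finally show ?thesis by simp
qed (simp add: eberlein_bound_def binomial_eq_0)

text \<open>Serves two recursion steps at once, where the middle coefficient does not vanish. All
  binomials are expressed through \<open>2 * k + 1 choose (k + 1)\<close>; equality holds at
  \<open>k = 0\<close>.\<close>

lemma eberlein_bound_middle_le:
  "eberlein_bound (2 * k + 1) (k + 2) + 3 * eberlein_bound (2 * k + 1) (k + 1)
    \<le> eberlein_bound (2 * k + 3) (k + 2)"
proof -
  define c where "c = real (2 * k + 1 choose (k + 1))"
  define K where "K = real k"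
  have K: "K \<ge> 0" by (simp add: K_def)
  have 1: "real (2 * k + 2 choose (k + 2)) * (K + 2) = (2 * K + 2) * c"
    using Suc_times_choose_Suc[of "2 * k + 1" "k + 1"] by (simp add: c_def K_def algebra_simps)
  have "real (2 * k + 1 choose (k + 2)) * (2 * K + 2) = real (2 * k + 2 choose (k + 2)) * K"
    using Suc_times_choose[of "2 * k + 1" "k + 2"] by (simp add: K_def algebra_simps)
  with 1 have "(2 * K + 2) * (real (2 * k + 1 choose (k + 2)) * (K + 2)) = (2 * K + 2) * (K * c)"
    by (metis mult.assoc mult.commute)
  then have "real (2 * k + 1 choose (k + 2)) * (K + 2) = K * c"
    using K by (simp only: mult_cancel_left) simp
  then have a: "real (2 * k + 1 choose (k + 2)) = K * c / (K + 2)"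
    using K by (simp only: eq_divide_eq) simp
  have 2: "real (2 * k + 3 choose (k + 2)) * (K + 1) = real (2 * k + 2 choose (k + 2)) * (2 * K + 3)"
    using Suc_times_choose[of "2 * k + 2" "k + 2"]
    by (simp add: K_def algebra_simps numeral_3_eq_3)
  have "(K + 1) * (real (2 * k + 3 choose (k + 2)) * (K + 2))
      = (real (2 * k + 2 choose (k + 2)) * (K + 2)) * (2 * K + 3)"
    using 2 by (metis mult.assoc mult.commute)
  also have "\<dots> = (K + 1) * (2 * (2 * K + 3) * c)"
    unfolding 1 by (simp add: algebra_simps)
  finally have "(K + 1) * (real (2 * k + 3 choose (k + 2)) * (K + 2)) = (K + 1) * (2 * (2 * K + 3) * c)" .
  then have "real (2 * k + 3 choose (k + 2)) * (K + 2) = 2 * (2 * K + 3) * c"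
    using K by (simp only: mult_cancel_left) simp
  then have b: "real (2 * k + 3 choose (k + 2)) = 2 * (2 * K + 3) * c / (K + 2)"
    using K by (simp only: eq_divide_eq) simp
  have "eberlein_bound (2 * k + 3) (k + 2)
      - (eberlein_bound (2 * k + 1) (k + 2) + 3 * eberlein_bound (2 * k + 1) (k + 1))
     = (2 * (2 * K + 3) * c / (K + 2))\<^sup>2 / (2 * K + 3)
       - ((K * c / (K + 2))\<^sup>2 * 3 / (2 * K + 1) + 3 * (c\<^sup>2 / (2 * K + 1)))"
    unfolding eberlein_bound_def a b c_def[symmetric] by (simp add: K_def add.commute[of 1])
  also have "\<dots> = 10 * c\<^sup>2 * K / ((K + 2) * (2 * K + 1))"
    using K by (simp add: divide_simps) (simp add: algebra_simps power2_eq_square)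
  also have "\<dots> \<ge> 0"
    using K by simp
  finally show ?thesis by simp
qed

lemma abs_eberlein_le:
  "0 < i \<Longrightarrow> m + i < 2 * j \<Longrightarrow> \<bar>eberlein m i j\<bar> \<le> eberlein_bound (m + i) j"
proof (induction i arbitrary: j rule: less_induct)
  case (less i)
  then obtain j' where j: "j = Suc j'" by (cases j) auto
  show ?case
  proof (cases "i = 1")
    case True
    with less.prems show ?thesis
      by (simp only: j eberlein_one) (simp add: eberlein_bound_nonneg)
  next
    case False
    with less.prems obtain i' where i: "i = Suc (Suc i')"
      by (metis One_nat_def gr0_implies_Suc neq0_conv)
    have eb: "eberlein m i j = eberlein m (Suc i') j - eberlein m (Suc i') j'"
      by (simp only: i j eberlein_Suc_Suc)
    show ?thesis
    \<comment> \<open>From \<open>m + i < 2 * j\<close> follows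
      \<open>m + Suc i' \<le> 2 * j'\<close>, so the second term of the recursion meets the
      hypothesis unless \<open>j'\<close> is the middle index. There symmetry kills the term if
      \<open>Suc i'\<close> is odd, which leaves \<open>i'\<close> odd as the hard case.\<close>
    proof (cases "m + Suc i' = 2 * j' \<and> odd i'")
      case False
      have "\<bar>eberlein m (Suc i') j'\<bar> \<le> eberlein_bound (m + Suc i') j'"
      proof (cases "m + Suc i' < 2 * j'")
        case True
        then show ?thesis by (intro less.IH) (auto simp: i)
      next
        case nl: False
        with less.prems have *: "m + Suc i' = 2 * j'" by (simp add: i j)
        with False have "odd (Suc i')" by simp
        with * have "eberlein m (Suc i') j' = 0"
          using eberlein_symmetric[of j' j' m "Suc i'"] by simp
        moreover have "eberlein_bound (m + Suc i') j' = 0"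
          unfolding * by (simp add: eberlein_bound_def)
        ultimately show ?thesis by simp
      qed
      moreover have "\<bar>eberlein m (Suc i') j\<bar> \<le> eberlein_bound (m + Suc i') j"
        using less.prems by (intro less.IH) (auto simp: i)
      moreover have "eberlein_bound (m + Suc i') j + eberlein_bound (m + Suc i') j'
          \<le> eberlein_bound (m + i) j"
        using eberlein_bound_add_le[of "m + Suc i'" j'] less.prems by (simp add: i j)
      ultimately show ?thesis unfolding eb by linarith
    next
      case True
      \<comment> \<open>Here the bound for \<open>E\<^sub>j'\<close>, the middle coefficient, is \<open>0\<close> while \<open>E\<^sub>j'\<close> itself is not,
        so the recursion is applied twice.\<close>
      then obtain k where j': "j' = Suc k" by (cases j') auto
      have mi: "m + i' = 2 * k + 1" using True j' by simp
      \<comment> \<open>\<open>k\<close> and \<open>j'\<close> are mirror images since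
        \<open>m + i' = k + j'\<close>, and \<open>i'\<close> is odd. This turns the double
        recursion, with coefficients 1, -2, 1, into 1, -3.\<close>
      have "eberlein m i' j' = - eberlein m i' k"
        using eberlein_symmetric[of k j' m i'] True by (simp add: j')
      then have "eberlein m i j = eberlein m i' j - 3 * eberlein m i' j'"
        unfolding eb unfolding j j' eberlein_Suc_Suc by simp
      moreover have "\<bar>eberlein m i' j\<bar> \<le> eberlein_bound (m + i') j"
          "\<bar>eberlein m i' j'\<bar> \<le> eberlein_bound (m + i') j'"
        using True mi by (intro less.IH; auto simp: i j j' intro: Nat.gr0I)+
      moreover have "eberlein_bound (m + i') j + 3 * eberlein_bound (m + i') j'
          \<le> eberlein_bound (m + i) j"
        using eberlein_bound_middle_le[of k] mi
        by (simp add: i j j' numeral_3_eq_3)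
      ultimately show ?thesis by linarith
    qed
  qed
qed

text \<open>Compares the bound with the valency \<open>E_j(0)\<close>, using
  \<open>2 * j - d \<le> d\<close>.\<close>

lemma eberlein_bound_le:
  assumes "j \<le> d" "0 < d"
  shows "eberlein_bound d j \<le> (real (d choose j))\<^sup>2"
  using assms mult_left_mono[of "2 * real j - real d" "real d" "(real (d choose j))\<^sup>2"]
  by (simp add: eberlein_bound_def divide_le_eq)

subsection \<open>Signed sums over pairs\<close>

definition ksubsets :: "'a set \<Rightarrow> nat \<Rightarrow> 'a set set" where
  "ksubsets X k = {A. A \<subseteq> X \<and> card A = k}"

lemma finite_ksubsets [simp]: "finite X \<Longrightarrow> finite (ksubsets X k)"
  by (auto simp: ksubsets_def)

text \<open>Deleting each pair from the ground set makes the pairs disjoint. A list lets the first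
  pair be peeled off, and the order within a pair fixes the sign.\<close>

fun pair_list_on :: "'a set \<Rightarrow> ('a \<times> 'a) list \<Rightarrow> bool" where
  "pair_list_on X [] \<longleftrightarrow> True"
| "pair_list_on X ((a, b) # ps) \<longleftrightarrow> a \<in> X \<and> b \<in> X \<and> a \<noteq> b \<and> pair_list_on (X - {a, b}) ps"

text \<open>The weight of \<open>A\<close> in the product of the forms \<open>x\<^sub>a - x\<^sub>b\<close> over the pairs \<open>(a, b)\<close>: it is \<open>0\<close> unless
  \<open>A\<close> contains exactly one point of every pair.\<close>

fun pair_sign :: "('a \<times> 'a) list \<Rightarrow> 'a set \<Rightarrow> real" where
  "pair_sign [] A = 1"
| "pair_sign ((a, b) # ps) A = (of_bool (a \<in> A) - of_bool (b \<in> A)) * pair_sign ps A"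

text \<open>Applied to \<open>X - {a, b}\<close>: the sign over the remaining pairs ignores
  insertion or removal of \<open>a\<close> and \<open>b\<close>.\<close>

lemma pair_sign_cong:
  "pair_list_on X ps \<Longrightarrow> A \<inter> X = B \<inter> X \<Longrightarrow> pair_sign ps A = pair_sign ps B"
proof (induction X ps rule: pair_list_on.induct)
  case (2 X a b ps)
  then have "a \<in> A \<longleftrightarrow> a \<in> B" "b \<in> A \<longleftrightarrow> b \<in> B" "A \<inter> (X - {a, b}) = B \<inter> (X - {a, b})"
    by auto
  with 2 show ?case by simp
qed simp

lemma length_pair_list_on:
  "finite X \<Longrightarrow> pair_list_on X ps \<Longrightarrow> 2 * length ps \<le> card X"
proof (induction X ps rule: pair_list_on.induct)
  case (2 X a b ps)
  then have "2 \<le> card X" "card (X - {a, b}) = card X - 2"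
    using card_mono[of X "{a, b}"] by (simp_all add: card_Diff_subset)
  with 2 show ?case by auto
qed simp

lemma sum_ksubsets_insert:
  assumes "finite X" "a \<in> X" "b \<in> X" "a \<noteq> b"
  shows "(\<Sum>A \<in> {A \<in> ksubsets X (Suc k). a \<in> A \<and> b \<notin> A}. g A)
    = (\<Sum>C \<in> ksubsets (X - {a, b}) k. g (insert a C))"
proof (rule sum.reindex_bij_witness[of _ "insert a" "\<lambda>A. A - {a}"])
  fix C assume "C \<in> ksubsets (X - {a, b}) k"
  moreover from this have "finite C" "a \<notin> C" using assms(1)
    by (auto simp: ksubsets_def dest: finite_subset)
  ultimately show "insert a C \<in> {A \<in> ksubsets X (Suc k). a \<in> A \<and> b \<notin> A}"
    using assms by (auto simp: ksubsets_def)
qed (use assms in \<open>auto simp: ksubsets_def insert_absorb\<close>)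

text \<open>Subsets with both or neither of \<open>a\<close>, \<open>b\<close> contribute zero; the
  others are \<open>insert a C\<close> or \<open>insert b C\<close>. This peels off a pair, both for
  completeness and for computing eigenvalues.\<close>

lemma sum_pair_difference:
  fixes g :: "'a set \<Rightarrow> real"
  assumes "finite X" "a \<in> X" "b \<in> X" "a \<noteq> b"
  shows "(\<Sum>A \<in> ksubsets X (Suc k). (of_bool (a \<in> A) - of_bool (b \<in> A)) * g A)
    = (\<Sum>C \<in> ksubsets (X - {a, b}) k. g (insert a C) - g (insert b C))"
proof -
  let ?S = "\<lambda>a b. {A \<in> ksubsets X (Suc k). a \<in> A \<and> b \<notin> A}"
  have "(\<Sum>A \<in> ksubsets X (Suc k). (of_bool (a \<in> A) - of_bool (b \<in> A)) * g A)
      = (\<Sum>A \<in> ksubsets X (Suc k). (if a \<in> A \<and> b \<notin> A then g A else 0)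
          - (if b \<in> A \<and> a \<notin> A then g A else 0))"
    by (rule sum.cong) auto
  also have "\<dots> = sum g (?S a b) - sum g (?S b a)"
    using assms(1) by (simp add: sum_subtractf sum.inter_filter)
  also have "\<dots> = (\<Sum>C \<in> ksubsets (X - {a, b}) k. g (insert a C) - g (insert b C))"
    using assms sum_ksubsets_insert[of X a b g k] sum_ksubsets_insert[of X b a g k]
    by (simp add: sum_subtractf insert_commute)
  finally show ?thesis .
qed

section \<open>Completeness of the pair signs\<close>

lemma constant_on_ksubsets:
  assumes "finite X"
    and exch: "\<And>a b C. a \<in> X \<Longrightarrow> b \<in> X \<Longrightarrow> a \<noteq> b \<Longrightarrow> C \<in> ksubsets (X - {a, b}) k
      \<Longrightarrow> f (insert a C) = f (insert b C)"
    and "A \<in> ksubsets X (Suc k)" "B \<in> ksubsets X (Suc k)"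
  shows "f A = f B"
  using assms(3)
proof (induction "card (A - B)" arbitrary: A)
  case 0
  then have "finite A" "finite B" using assms(1,4) by (auto simp: ksubsets_def dest: finite_subset)
  with 0 assms(4) have "A = B" by (intro card_subset_eq) (auto simp: ksubsets_def)
  then show ?case by simp
next
  case (Suc n)
  then have fin: "finite A" "finite B" using assms(1,4) by (auto simp: ksubsets_def dest: finite_subset)
  from Suc.hyps(2) obtain a where a: "a \<in> A" "a \<notin> B"
    by (metis DiffD1 DiffD2 card.empty ex_in_conv nat.distinct(1))
  have "\<not> B \<subseteq> A"
    using a fin Suc.prems assms(4) card_subset_eq[of A B] by (auto simp: ksubsets_def)
  then obtain b where b: "b \<in> B" "b \<notin> A" by auto
  \<comment> \<open>Exchanging \<open>a\<close> for \<open>b\<close> brings \<open>A\<close> one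
    element closer to \<open>B\<close>.\<close>
  let ?C = "A - {a}"
  have C: "?C \<in> ksubsets (X - {a, b}) k"
    using Suc.prems a b by (auto simp: ksubsets_def)
  have ab: "a \<in> X" "b \<in> X" "a \<noteq> b"
    using Suc.prems assms(4) a b by (auto simp: ksubsets_def)
  have "insert b ?C - B = (A - B) - {a}" using a b by auto
  then have "n = card (insert b ?C - B)"
    using Suc.hyps(2) a fin by simp
  moreover have "insert b ?C \<in> ksubsets X (Suc k)"
    using C ab fin b by (auto simp: ksubsets_def)
  ultimately have "f (insert b ?C) = f B" by (rule Suc.hyps(1))
  moreover have "f (insert a ?C) = f (insert b ?C)"
    by (rule exch[OF ab C])
  ultimately show ?case using a by (simp add: insert_absorb)
qed

lemma pair_signs_span:
  fixes f :: "'a set \<Rightarrow> real"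
  assumes "finite X" "\<And>ps. pair_list_on X ps \<Longrightarrow> (\<Sum>A \<in> ksubsets X k. pair_sign ps A * f A) = 0"
    and "A \<in> ksubsets X k"
  shows "f A = 0"
  using assms
proof (induction k arbitrary: X f A)
  case 0
  have "ksubsets X 0 = {{}}" using 0(1) by (auto simp: ksubsets_def dest: finite_subset)
  with 0(2)[of "[]"] 0(3) show ?case by simp
next
  case (Suc k)
  have "f (insert a C) = f (insert b C)"
    if ab: "a \<in> X" "b \<in> X" "a \<noteq> b" and C: "C \<in> ksubsets (X - {a, b}) k" for a b C
  proof -
    \<comment> \<open>Orthogonality of \<open>f\<close> to \<open>(a, b) # ps\<close> on
      \<open>X\<close> is orthogonality of the difference to \<open>ps\<close> on
      \<open>X - {a, b}\<close>, one size lower.\<close>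
    have sum0: "(\<Sum>C \<in> ksubsets (X - {a, b}) k. pair_sign ps C * (f (insert a C) - f (insert b C))) = 0"
      if ps: "pair_list_on (X - {a, b}) ps" for ps
    proof -
      have "pair_sign ps (insert a C) = pair_sign ps C" "pair_sign ps (insert b C) = pair_sign ps C" for C
        by (rule pair_sign_cong[OF ps]; auto)+
      moreover have "pair_list_on X ((a, b) # ps)" using ab ps by simp
      from Suc.prems(2)[OF this]
      have "(\<Sum>A \<in> ksubsets X (Suc k).
          (of_bool (a \<in> A) - of_bool (b \<in> A)) * (pair_sign ps A * f A)) = 0"
        by (simp add: mult.assoc)
      ultimately show ?thesis
        using sum_pair_difference[OF Suc.prems(1) ab, where k = k and g = "\<lambda>A. pair_sign ps A * f A"]
        by (simp add: right_diff_distrib)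
    qed
    have "finite (X - {a, b})" using Suc.prems(1) by simp
    from Suc.IH[OF this sum0 C] show ?thesis by simp
  qed
  then have const: "f B = f A" if "B \<in> ksubsets X (Suc k)" for B
    using constant_on_ksubsets[OF Suc.prems(1), of k f B A] Suc.prems(3) that by blast
  \<comment> \<open>The empty list has sign 1 everywhere, so the constant value of \<open>f\<close>
    sums to zero over a nonempty family.\<close>
  have "(\<Sum>B \<in> ksubsets X (Suc k). f B) = 0" using Suc.prems(2)[of "[]"] by simp
  then have "real (card (ksubsets X (Suc k))) * f A = 0" by (simp add: const)
  moreover have "card (ksubsets X (Suc k)) \<noteq> 0"
    using Suc.prems(1,3) by (auto simp: card_eq_0_iff)
  ultimately show ?case by simp
qed

section \<open>Action of the adjacency relation on the pair signs\<close>

lemma card_ksubsets_inter: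
  assumes "finite X" "card X = 2 * k" "B \<in> ksubsets X k"
  shows "card {A \<in> ksubsets X k. card (A \<inter> B) + j = k} = (k choose j)\<^sup>2"
proof (cases "j \<le> k")
  case True
  have B: "B \<subseteq> X" "card B = k" "finite B" "finite (X - B)"
    using assms by (auto simp: ksubsets_def dest: finite_subset)
  then have cXB: "card (X - B) = k" using assms(2) by (simp add: card_Diff_subset)
  \<comment> \<open>\<open>A\<close> splits into \<open>k - j\<close> points of \<open>B\<close> and
    \<open>j\<close> points of its complement, which also has \<open>k\<close> points; hence the
    square of one binomial.\<close>
  let ?T = "ksubsets B (k - j) \<times> ksubsets (X - B) j"
  have "bij_betw (\<lambda>A. (A \<inter> B, A - B)) {A \<in> ksubsets X k. card (A \<inter> B) + j = k} ?T"
  proof (rule bij_betw_byWitness[where f' = "\<lambda>(P, Q). P \<union> Q"])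
    show "(\<lambda>A. (A \<inter> B, A - B)) ` {A \<in> ksubsets X k. card (A \<inter> B) + j = k} \<subseteq> ?T"
    proof (rule image_subsetI)
      fix A assume "A \<in> {A \<in> ksubsets X k. card (A \<inter> B) + j = k}"
      then have A: "A \<subseteq> X" "card A = k" "card (A \<inter> B) + j = k" by (auto simp: ksubsets_def)
      then have "finite A" using assms(1) finite_subset by blast
      then have "card A = card (A \<inter> B) + card (A - B)"
        by (rule card_Int_Diff)
      with A show "(A \<inter> B, A - B) \<in> ?T"
        by (auto simp: ksubsets_def)
    qed
    show "(\<lambda>(P, Q). P \<union> Q) ` ?T \<subseteq> {A \<in> ksubsets X k. card (A \<inter> B) + j = k}"
    proof (rule image_subsetI)
      fix z assume "z \<in> ?T"
      then obtain P Q where z: "z = (P, Q)" and PQ: "P \<subseteq> B" "card P = k - j" "Q \<subseteq> X - B" "card Q = j"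
        by (auto simp: ksubsets_def)
      then have fin: "finite P" "finite Q" "P \<inter> Q = {}" and inter: "(P \<union> Q) \<inter> B = P"
        using B finite_subset by blast+
      have "card (P \<union> Q) = k"
        using fin PQ True by (simp add: card_Un_disjoint)
      with PQ B(1) True show "(\<lambda>(P, Q). P \<union> Q) z \<in> {A \<in> ksubsets X k. card (A \<inter> B) + j = k}"
        by (auto simp: z inter ksubsets_def)
    qed
    show "\<forall>z \<in> ?T. ((case z of (P, Q) \<Rightarrow> P \<union> Q) \<inter> B, (case z of (P, Q) \<Rightarrow> P \<union> Q) - B) = z"
    proof
      fix z assume "z \<in> ?T"
      then obtain P Q where z: "z = (P, Q)" and "P \<subseteq> B" "Q \<subseteq> X - B"
        by (auto simp: ksubsets_def)
      then have "(P \<union> Q) \<inter> B = P" "P \<union> Q - B = Q" by blast+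
      then show "((case z of (P, Q) \<Rightarrow> P \<union> Q) \<inter> B, (case z of (P, Q) \<Rightarrow> P \<union> Q) - B) = z"
        by (simp add: z)
    qed
  qed (simp add: Int_Diff_Un)
  then have "card {A \<in> ksubsets X k. card (A \<inter> B) + j = k} = card ?T"
    by (rule bij_betw_same_card)
  also have "\<dots> = (k choose j)\<^sup>2"
    using B cXB binomial_symmetric[OF True]
    by (simp add: card_cartesian_product ksubsets_def n_subsets power2_eq_square)
  finally show ?thesis .
next
  case False
  then have "{A \<in> ksubsets X k. card (A \<inter> B) + j = k} = {}" by auto
  then show ?thesis using False by (simp only: card.empty) (simp add: binomial_eq_0)
qed

text \<open>Induction peels off the first pair. If \<open>B\<close> contains both or neither of its
  points, both sides vanish. Otherwise deleting the point from \<open>B\<close> leads one size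
  lower, where the two indicators belong to \<open>j\<close> and \<open>j - 1\<close>, and
  \<open>eberlein_Suc_Suc\<close> applies. The additive form of the condition avoids truncated
  subtraction for \<open>j > k\<close>.\<close>

lemma sum_pair_sign_johnson:
  assumes "finite X" "card X = 2 * k" "B \<in> ksubsets X k" "pair_list_on X ps"
  shows "(\<Sum>A \<in> ksubsets X k. of_bool (card (A \<inter> B) + j = k) * pair_sign ps A)
    = eberlein (k - length ps) (length ps) j * pair_sign ps B"
  using assms
proof (induction ps arbitrary: X k B j)
  case Nil
  have "(\<Sum>A \<in> ksubsets X k. of_bool (card (A \<inter> B) + j = k) :: real)
      = real (card {A \<in> ksubsets X k. card (A \<inter> B) + j = k})"
    using Nil.prems(1) by (simp add: Int_def)
  also have "\<dots> = (real (k choose j))\<^sup>2"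
    using Nil.prems by (simp add: card_ksubsets_inter)
  finally show ?case by simp
next
  case (Cons p ps)
  obtain a b where p: "p = (a, b)" by fastforce
  let ?X = "X - {a, b}" and ?i = "length ps"
  from Cons.prems(4) p have ab: "a \<in> X" "b \<in> X" "a \<noteq> b" and ps: "pair_list_on ?X ps"
    by auto
  from length_pair_list_on[OF Cons.prems(1,4)] Cons.prems(2)
  obtain k' where k: "k = Suc k'" by (cases k) auto
  have X: "finite ?X" "card ?X = 2 * k'"
    using Cons.prems(1,2) ab k by (auto simp: card_Diff_subset)
  have sgn: "pair_sign ps (insert a C) = pair_sign ps C" "pair_sign ps (insert b C) = pair_sign ps C"
    "pair_sign ps (C - {a}) = pair_sign ps C" "pair_sign ps (C - {b}) = pair_sign ps C" for C
    by (rule pair_sign_cong[OF ps]; auto)+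
  define S where "S j B' = (\<Sum>C \<in> ksubsets ?X k'. of_bool (card (C \<inter> B') + j = k') * pair_sign ps C)"
    for j B'
  have IH: "S j B' = eberlein (k' - ?i) ?i j * pair_sign ps B'" if "B' \<in> ksubsets ?X k'" for j B'
    unfolding S_def by (rule Cons.IH[OF X that ps])
  have eq: "(\<Sum>A \<in> ksubsets X k. of_bool (card (A \<inter> B) + j = k) * pair_sign (p # ps) A)
    = (\<Sum>C \<in> ksubsets ?X k'. (of_bool (card (insert a C \<inter> B) + j = k)
        - of_bool (card (insert b C \<inter> B) + j = k)) * pair_sign ps C)"
    using sum_pair_difference[OF Cons.prems(1) ab,
        where k = k' and g = "\<lambda>A. of_bool (card (A \<inter> B) + j = k) * pair_sign ps A"]
    by (simp add: k p sgn algebra_simps del: of_bool_eq_iff)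
  \<comment> \<open>Stated for \<open>x\<close> and \<open>y\<close> to cover either point of the
    pair lying in \<open>B\<close>.\<close>
  have exch: "(\<Sum>C \<in> ksubsets ?X k'. (of_bool (card (insert x C \<inter> B) + j = k)
        - of_bool (card (insert y C \<inter> B) + j = k)) * pair_sign ps C)
      = eberlein (k' - ?i) (Suc ?i) j * pair_sign ps B"
    if xy: "{x, y} = {a, b}" "x \<in> B" "y \<notin> B" for x y
  proof -
    have x: "x \<noteq> y" "x = a \<or> x = b" using xy(1) ab by auto
    define B' where "B' = B - {x}"
    have fB: "finite B" using Cons.prems(1,3) by (auto simp: ksubsets_def dest: finite_subset)
    have B': "B' \<in> ksubsets ?X k'"
      using Cons.prems(3) xy fB unfolding xy(1)[symmetric] by (auto simp: ksubsets_def B'_def k)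
    have sB': "pair_sign ps B' = pair_sign ps B"
      using x(2) sgn unfolding B'_def by auto
    have c: "card (insert x C \<inter> B) = Suc (card (C \<inter> B'))" "card (insert y C \<inter> B) = card (C \<inter> B')"
      "card (C \<inter> B') \<le> k'" if C: "C \<in> ksubsets ?X k'" for C
    proof -
      have C': "x \<notin> C" "y \<notin> C" "card C = k'" "finite C"
        using C Cons.prems(1) unfolding xy(1)[symmetric]
        by (auto simp: ksubsets_def dest: finite_subset)
      then have "insert x C \<inter> B = insert x (C \<inter> B')" "insert y C \<inter> B = C \<inter> B'"
        using xy by (auto simp: B'_def)
      with C' show "card (insert x C \<inter> B) = Suc (card (C \<inter> B'))"
        "card (insert y C \<inter> B) = card (C \<inter> B')" "card (C \<inter> B') \<le> k'"
        by (auto intro: card_mono)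
    qed
    show ?thesis
    proof (cases j)
      \<comment> \<open>The second indicator is always 0 here, since \<open>C \<inter> B'\<close>
        has at most \<open>k'\<close> points.\<close>
      case 0
      have "(\<Sum>C \<in> ksubsets ?X k'. (of_bool (card (insert x C \<inter> B) + j = k)
          - of_bool (card (insert y C \<inter> B) + j = k)) * pair_sign ps C) = S 0 B'"
        unfolding S_def using c by (intro sum.cong refl) (fastforce simp: 0 k)
      then show ?thesis by (simp add: IH[OF B'] 0 sB')
    next
      case (Suc j')
      have "(\<Sum>C \<in> ksubsets ?X k'. (of_bool (card (insert x C \<inter> B) + j = k)
          - of_bool (card (insert y C \<inter> B) + j = k)) * pair_sign ps C) = S j B' - S j' B'"
        unfolding S_def sum_subtractf[symmetric] using c
        by (intro sum.cong refl) (simp add: Suc k algebra_simps)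
      then show ?thesis by (simp add: IH[OF B'] Suc sB' eberlein_Suc_Suc left_diff_distrib)
    qed
  qed
  consider "a \<in> B \<longleftrightarrow> b \<in> B" | "a \<in> B" "b \<notin> B" | "b \<in> B" "a \<notin> B" by auto
  then show ?case
  proof cases
    case 1
    have "card (insert a C \<inter> B) = card (insert b C \<inter> B)" if C: "C \<in> ksubsets ?X k'" for C
    proof -
      have "a \<notin> C" "b \<notin> C" "finite C" using C Cons.prems(1)
        by (auto simp: ksubsets_def dest: finite_subset)
      then show ?thesis using 1 by (cases "a \<in> B") auto
    qed
    then show ?thesis unfolding eq using 1 by (simp add: p)
  next
    case 2
    then show ?thesis using exch[of a b] unfolding eq by (simp add: p k)
  next
    case 3
    \<comment> \<open>Swapping \<open>a\<close> and \<open>b\<close> negates the sum, matching the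
      factor -1 in the sign of \<open>B\<close>.\<close>
    have "(\<Sum>C \<in> ksubsets ?X k'. (of_bool (card (insert a C \<inter> B) + j = k)
        - of_bool (card (insert b C \<inter> B) + j = k)) * pair_sign ps C)
      = - (\<Sum>C \<in> ksubsets ?X k'. (of_bool (card (insert b C \<inter> B) + j = k)
        - of_bool (card (insert a C \<inter> B) + j = k)) * pair_sign ps C)"
      unfolding sum_negf[symmetric] by (rule sum.cong) (simp_all add: algebra_simps)
    then show ?thesis using 3 exch[of b a] unfolding eq by (simp add: p k insert_commute)
  qed
qed

subsection \<open>Matrices with constant column sums\<close>

lemma char_poly_four_block_zeros_row:
  fixes A1 :: "'a :: idom mat"
  assumes "A1 \<in> carrier_mat n n" "A3 \<in> carrier_mat m n" "A4 \<in> carrier_mat m m"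
  shows "char_poly (four_block_mat A1 (0\<^sub>m n m) A3 A4) = char_poly A1 * char_poly A4"
proof -
  have "char_poly_matrix (four_block_mat A1 (0\<^sub>m n m) A3 A4)
      = four_block_mat (char_poly_matrix A1) (0\<^sub>m n m) (map_mat (\<lambda>a. [:- a:]) A3) (char_poly_matrix A4)"
    unfolding char_poly_matrix_def using assms by (intro eq_matI) (auto simp: one_poly_def)
  then show ?thesis
    unfolding char_poly_def using assms
    by (simp add: det_four_block_mat_upper_right_zero[of _ n _ m])
qed

text \<open>The all-ones row vector is a left eigenvector of \<open>A\<close>; taking it as the first coordinate
  splits off the eigenvalue \<open>k\<close> and leaves \<open>A\<close> acting on the vectors of coordinate sum \<open>0\<close>.\<close>

lemma spectrum_mset_const_col_sum:
  fixes A :: "real mat"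
  assumes A: "A \<in> carrier_mat n n" and "0 < n"
    and col: "\<And>c. c < n \<Longrightarrow> (\<Sum>r<n. A $$ (r, c)) = k"
  shows "k \<in># spectrum_mset A"
    and "z \<in># spectrum_mset A - {#k#} \<Longrightarrow>
      \<exists>v \<in> carrier_vec n. v \<noteq> 0\<^sub>v n \<and> A *\<^sub>v v = z \<cdot>\<^sub>v v \<and> (\<Sum>r<n. v $ r) = 0"
proof -
  obtain m where n: "n = 1 + m" using assms(2) by (metis Suc_pred' plus_1_eq_Suc)
  \<comment> \<open>\<open>P\<close> replaces the first coordinate of a vector by its coordinate
    sum; \<open>Q\<close> is the inverse.\<close>
  define P where "P = mat n n (\<lambda>(r, c). if r = 0 \<or> r = c then 1 else (0 :: real))"
  define Q where "Q = mat n n (\<lambda>(r, c). if r = c then 1 else if r = 0 then - 1 else (0 :: real))"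
  have P: "P \<in> carrier_mat n n" and Q: "Q \<in> carrier_mat n n" by (simp_all add: P_def Q_def)
  have PQ: "P * Q = 1\<^sub>m n"
  proof (rule eq_matI)
    fix r c assume "r < dim_row (1\<^sub>m n :: real mat)" "c < dim_col (1\<^sub>m n :: real mat)"
    then have rc: "r < n" "c < n" by auto
    have "(P * Q) $$ (r, c) = (\<Sum>s<n. P $$ (r, s) * Q $$ (s, c))"
      using rc by (simp add: P_def Q_def scalar_prod_def lessThan_atLeast0)
    also have "\<dots> = (\<Sum>s<n. (if s = r then of_bool (r = c) - of_bool (r = 0 \<and> c \<noteq> 0) else 0)
        + (if s = c then of_bool (r = 0 \<and> c \<noteq> 0) else 0))"
      using rc by (intro sum.cong refl) (auto simp: P_def Q_def)
    also have "\<dots> = 1\<^sub>m n $$ (r, c)"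
      using rc by (simp add: sum.distrib)
    finally show "(P * Q) $$ (r, c) = 1\<^sub>m n $$ (r, c)" .
  qed (simp_all add: P_def Q_def)
  have QP: "Q * P = 1\<^sub>m n" by (rule mat_mult_left_right_inverse[OF P Q PQ])
  define B where "B = P * A * Q"
  have B: "B \<in> carrier_mat n n" using P A Q by (simp add: B_def)
  have row0: "(P *\<^sub>v v) $ 0 = (\<Sum>r<n. v $ r)" if "v \<in> carrier_vec n" for v
    using that assms(2) by (simp add: P_def scalar_prod_def lessThan_atLeast0)
  \<comment> \<open>Row 0 of \<open>P\<close> is the all-ones row, so row 0 of \<open>P * A\<close>
    is \<open>k\<close> times it, and \<open>Q\<close> turns it into \<open>k\<close> times the
    first unit row.\<close>
  have B0: "B $$ (0, c) = (if c = 0 then k else 0)" if c: "c < n" for c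
  proof -
    have row: "row (P * A) 0 = k \<cdot>\<^sub>v row P 0"
      using assms(2) A col by (intro eq_vecI) (simp_all add: P_def scalar_prod_def lessThan_atLeast0)
    have "B $$ (0, c) = row (P * A) 0 \<bullet> col Q c"
      unfolding B_def by (rule index_mult_mat(1)) (use c assms(2) P Q in auto)
    also have "\<dots> = k * (P * Q) $$ (0, c)"
      unfolding row using c assms(2) P Q by simp
    also have "\<dots> = (if c = 0 then k else 0)" using c assms(2) by (simp add: PQ)
    finally show ?thesis .
  qed
  define B1 where "B1 = mat 1 1 (\<lambda>_. k)"
  define B3 where "B3 = mat m 1 (\<lambda>(r, c). B $$ (Suc r, c))"
  define B4 where "B4 = mat m m (\<lambda>(r, c). B $$ (Suc r, Suc c))"
  have Bs: "B1 \<in> carrier_mat 1 1" "B3 \<in> carrier_mat m 1" "B4 \<in> carrier_mat m m"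
    by (simp_all add: B1_def B3_def B4_def)
  have B_block: "B = four_block_mat B1 (0\<^sub>m 1 m) B3 B4"
    using B B0 by (intro eq_matI) (auto simp: B1_def B3_def B4_def n)
  have "similar_mat B A"
    by (rule similar_matI[of _ _ P Q n]) (use P Q PQ QP A B in \<open>auto simp: B_def\<close>)
  then have "char_poly A = char_poly B" by (metis char_poly_similar)
  also have "\<dots> = char_poly B1 * char_poly B4"
    unfolding B_block by (rule char_poly_four_block_zeros_row[OF Bs])
  also have "char_poly B1 = [:- k, 1:]"
    by (subst char_poly_upper_triangular[of _ 1]) (auto simp: B1_def diag_mat_def)
  finally have cp: "char_poly A = [:- k, 1:] * char_poly B4" .
  have nz: "char_poly B4 \<noteq> 0"
    using degree_monic_char_poly[OF Bs(3)] by auto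
  \<comment> \<open>Exactly one copy of \<open>k\<close> splits off; any further copies are roots
    belonging to \<open>B4\<close>, so \<open>z = k\<close> needs no separate treatment
    below.\<close>
  have spec: "spectrum_mset A = {#k#} + proots (char_poly B4)"
    unfolding spectrum_mset_def cp using nz by (subst proots_mult) auto
  show "k \<in># spectrum_mset A" unfolding spec by simp
  assume "z \<in># spectrum_mset A - {#k#}"
  then have "poly (char_poly B4) z = 0" unfolding spec using nz by simp
  then have "eigenvalue B4 z" using eigenvalue_root_char_poly[OF Bs(3)] by simp
  then obtain y where y: "y \<in> carrier_vec m" "y \<noteq> 0\<^sub>v m" "B4 *\<^sub>v y = z \<cdot>\<^sub>v y"
    using Bs(3) unfolding eigenvalue_def eigenvector_def by auto
  \<comment> \<open>The zero upper right block lets an eigenvector of \<open>B4\<close> lift to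
    \<open>B\<close> by prepending 0. In the original coordinates this 0 is the coordinate
    sum.\<close>
  define x where "x = 0\<^sub>v 1 @\<^sub>v y"
  have x: "x \<in> carrier_vec n" unfolding x_def n using y(1) by (intro append_carrier_vec) simp_all
  have xnz: "x \<noteq> 0\<^sub>v n"
  proof
    assume x0: "x = 0\<^sub>v n"
    have "y $ i = 0" if i: "i < m" for i
    proof -
      have "y $ i = x $ Suc i" using i y(1) by (simp add: x_def)
      also have "\<dots> = 0" using i by (simp add: x0 n)
      finally show ?thesis .
    qed
    with y(1,2) show False by (metis carrier_vecD eq_vecI index_zero_vec)
  qed
  have "w \<bullet> 0\<^sub>v (Suc 0) = (0 :: real)" for w by (simp add: scalar_prod_def)
  then have Bx: "B *\<^sub>v x = z \<cdot>\<^sub>v x"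
    unfolding B_block x_def
    by (subst four_block_mat_mult_vec[of _ 1 1 _ m _ m]) (use Bs y in \<open>auto simp: x_def intro!: eq_vecI\<close>)
  define v where "v = Q *\<^sub>v x"
  have v: "v \<in> carrier_vec n" using Q x by (simp add: v_def)
  have Pv: "P *\<^sub>v v = x"
    unfolding v_def using P Q PQ x by (simp flip: assoc_mult_mat_vec)
  have "A *\<^sub>v v = (Q * P) *\<^sub>v (A *\<^sub>v (Q *\<^sub>v x))"
    using A v by (simp add: QP v_def)
  also have "\<dots> = Q *\<^sub>v (B *\<^sub>v x)"
    unfolding B_def using P Q A x by (simp add: assoc_mult_mat_vec[of _ n n _ n])
  also have "\<dots> = z \<cdot>\<^sub>v v"
    unfolding Bx v_def using Q x by (simp add: mult_mat_vec)
  finally have "A *\<^sub>v v = z \<cdot>\<^sub>v v" .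
  moreover have "v \<noteq> 0\<^sub>v n" using Pv P xnz by auto
  moreover have "(\<Sum>r<n. v $ r) = 0"
    using row0[OF v] y(1) assms(2) by (simp add: Pv x_def n)
  ultimately show "\<exists>v \<in> carrier_vec n. v \<noteq> 0\<^sub>v n \<and> A *\<^sub>v v = z \<cdot>\<^sub>v v \<and> (\<Sum>r<n. v $ r) = 0"
    using v by blast
qed

subsection \<open>The spectrum of \<open>J(2d,d,j)\<close>\<close>

lemma pverts_johnson_graph: "pverts (johnson_graph X d j) = ksubsets X d"
  by (simp add: johnson_graph_def ksubsets_def)

locale johnson_enum =
  fixes d j :: nat and X :: "'a set" and vs :: "'a set list"
  assumes j_le: "j \<le> d" and fin: "finite X" and card_X: "card X = 2 * d"
    and dist: "distinct vs" and set_vs: "set vs = ksubsets X d"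
begin

abbreviation "M \<equiv> adjacency_matrix (johnson_graph X d j) vs"
abbreviation "N \<equiv> length vs"

lemma M_carrier: "M \<in> carrier_mat N N"
  by (simp add: adjacency_matrix_def)

lemma sum_vs: "(\<Sum>r<N. g (vs ! r)) = sum g (ksubsets X d)"
  using sum.reindex_bij_betw[OF bij_betw_nth[OF dist refl set_vs[symmetric]]] .

lemma nth_vs: "r < N \<Longrightarrow> vs ! r \<in> ksubsets X d"
  using set_vs nth_mem by blast

lemma M_entry:
  assumes "r < N" "c < N"
  shows "M $$ (r, c) = of_bool (card (vs ! r \<inter> vs ! c) + j = d)"
proof -
  have "card (vs ! r \<inter> vs ! c) = d - j \<longleftrightarrow> card (vs ! r \<inter> vs ! c) + j = d"
    using j_le by auto
  then show ?thesis
    using nth_vs[OF assms(1)] nth_vs[OF assms(2)] assms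
    by (simp add: adjacency_matrix_def johnson_graph_def ksubsets_def)
qed

lemma M_sym: "r < N \<Longrightarrow> c < N \<Longrightarrow> M $$ (r, c) = M $$ (c, r)"
  by (simp add: M_entry Int_commute)

text \<open>The pair signs form a left eigenvector, to be paired with arbitrary right eigenvectors;
  the empty list gives the constant column sums.\<close>

lemma sum_pair_sign_M:
  assumes "pair_list_on X ps" "c < N"
  shows "(\<Sum>r<N. pair_sign ps (vs ! r) * M $$ (r, c))
    = johnson_E (2 * d) d j (length ps) * pair_sign ps (vs ! c)"
proof -
  have len: "length ps \<le> d"
    using length_pair_list_on[OF fin assms(1)] card_X by simp
  have "(\<Sum>r<N. pair_sign ps (vs ! r) * M $$ (r, c))
      = (\<Sum>r<N. of_bool (card (vs ! r \<inter> vs ! c) + j = d) * pair_sign ps (vs ! r))"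
    using assms(2) by (intro sum.cong refl) (simp add: M_entry)
  also have "\<dots> = eberlein (d - length ps) (length ps) j * pair_sign ps (vs ! c)"
    using sum_vs[of "\<lambda>A. of_bool (card (A \<inter> vs ! c) + j = d) * pair_sign ps A"]
      sum_pair_sign_johnson[OF fin card_X nth_vs[OF assms(2)] assms(1)] by simp
  finally show ?thesis by (simp add: johnson_E_eq_eberlein[OF len])
qed

lemma mult_M_index:
  "v \<in> carrier_vec N \<Longrightarrow> r < N \<Longrightarrow> (M *\<^sub>v v) $ r = (\<Sum>c<N. M $$ (r, c) * v $ c)"
  using M_carrier by (simp add: scalar_prod_def lessThan_atLeast0)

lemma eigenvalue_johnson_E:
  assumes "pair_list_on X ps" "A \<in> ksubsets X d" "pair_sign ps A \<noteq> 0"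
  shows "eigenvalue M (johnson_E (2 * d) d j (length ps))"
proof -
  define v where "v = vec N (\<lambda>r. pair_sign ps (vs ! r))"
  have v: "v \<in> carrier_vec N" by (simp add: v_def)
  have "M *\<^sub>v v = johnson_E (2 * d) d j (length ps) \<cdot>\<^sub>v v"
  proof (rule eq_vecI)
    fix r assume "r < dim_vec (johnson_E (2 * d) d j (length ps) \<cdot>\<^sub>v v)"
    then have r: "r < N" by (simp add: v_def)
    have "(M *\<^sub>v v) $ r = (\<Sum>c<N. pair_sign ps (vs ! c) * M $$ (c, r))"
      unfolding mult_M_index[OF v r]
      by (rule sum.cong) (use r in \<open>auto simp: v_def M_sym[of r] mult.commute\<close>)
    then show "(M *\<^sub>v v) $ r = (johnson_E (2 * d) d j (length ps) \<cdot>\<^sub>v v) $ r"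
      using sum_pair_sign_M[OF assms(1) r] r by (simp add: v_def)
  qed (use M_carrier in \<open>simp add: v_def\<close>)
  moreover have "v \<noteq> 0\<^sub>v N"
  proof
    obtain r where r: "r < N" "vs ! r = A"
      using assms(2) set_vs by (metis in_set_conv_nth)
    assume "v = 0\<^sub>v N"
    then have "v $ r = 0" using r by simp
    with r assms(3) show False by (simp add: v_def)
  qed
  ultimately show ?thesis
    using v M_carrier unfolding eigenvalue_def eigenvector_def by auto
qed

text \<open>Pairing \<open>v\<close> with the left eigenvector of \<open>ps\<close> gives
  \<open>z * s = E_j(i) * s\<close> with \<open>i = length ps\<close>. Completeness supplies a list
  with \<open>s\<close> nonzero, and the zero sum excludes the empty list.\<close>

lemma eigenvector_eigenvalue:
  assumes v: "v \<in> carrier_vec N" "v \<noteq> 0\<^sub>v N" "M *\<^sub>v v = z \<cdot>\<^sub>v v" and sum0: "(\<Sum>r<N. v $ r) = 0"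
  shows "\<exists>i. 1 \<le> i \<and> i \<le> d \<and> z = johnson_E (2 * d) d j i"
proof -
  \<comment> \<open>Reads \<open>v\<close> as a function on \<open>d\<close>-subsets; the index is
    unique because \<open>vs\<close> is distinct.\<close>
  define f where "f A = v $ (THE r. r < N \<and> vs ! r = A)" for A
  have f: "f (vs ! r) = v $ r" if "r < N" for r
  proof -
    have "(THE s. s < N \<and> vs ! s = vs ! r) = r"
      using that dist by (auto simp: nth_eq_iff_index_eq)
    then show ?thesis by (simp add: f_def)
  qed
  have sum_f: "(\<Sum>A \<in> ksubsets X d. pair_sign ps A * f A) = (\<Sum>r<N. pair_sign ps (vs ! r) * v $ r)" for ps
    using f by (simp flip: sum_vs)
  have "\<exists>ps. pair_list_on X ps \<and> (\<Sum>A \<in> ksubsets X d. pair_sign ps A * f A) \<noteq> 0"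
  proof (rule ccontr)
    assume "\<not> ?thesis"
    then have "f A = 0" if "A \<in> ksubsets X d" for A
      using pair_signs_span[OF fin _ that] by blast
    then have "v $ r = 0" if "r < N" for r using that f nth_vs by metis
    with v(1,2) show False by (metis carrier_vecD eq_vecI index_zero_vec)
  qed
  then obtain ps where ps: "pair_list_on X ps" and nz: "(\<Sum>r<N. pair_sign ps (vs ! r) * v $ r) \<noteq> 0"
    unfolding sum_f by blast
  let ?E = "johnson_E (2 * d) d j (length ps)"
  have "z * (\<Sum>r<N. pair_sign ps (vs ! r) * v $ r) = (\<Sum>r<N. pair_sign ps (vs ! r) * (M *\<^sub>v v) $ r)"
    unfolding v(3) sum_distrib_left using v(1) by (intro sum.cong) auto
  also have "\<dots> = (\<Sum>r<N. \<Sum>c<N. pair_sign ps (vs ! r) * M $$ (r, c) * v $ c)"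
    using v(1) by (intro sum.cong refl) (simp add: mult_M_index sum_distrib_left mult.assoc del: index_mult_mat_vec)
  also have "\<dots> = (\<Sum>c<N. (\<Sum>r<N. pair_sign ps (vs ! r) * M $$ (r, c)) * v $ c)"
    by (subst sum.swap) (simp add: sum_distrib_right)
  also have "\<dots> = ?E * (\<Sum>r<N. pair_sign ps (vs ! r) * v $ r)"
    by (simp add: sum_pair_sign_M[OF ps] sum_distrib_left mult.assoc)
  finally have "z = ?E" using nz by simp
  moreover have "ps \<noteq> []" using nz sum0 by auto
  moreover have "length ps \<le> d"
    using length_pair_list_on[OF fin ps] card_X by simp
  ultimately show ?thesis by (intro exI[of _ "length ps"]) (simp add: Suc_le_eq)
qed

lemma N_pos: "0 < N"
proof -
  obtain A where "A \<subseteq> X" "card A = d"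
    using obtain_subset_with_card_n[of d X] card_X by auto
  then have "A \<in> set vs" by (simp add: set_vs ksubsets_def)
  then show ?thesis by (cases vs) auto
qed

lemma spectrum_johnson:
  shows "johnson_E (2 * d) d j 0 \<in># spectrum_mset M"
    and "z \<in># spectrum_mset M - {#johnson_E (2 * d) d j 0#} \<Longrightarrow>
      \<exists>i. 1 \<le> i \<and> i \<le> d \<and> z = johnson_E (2 * d) d j i"
proof -
  have col: "(\<Sum>r<N. M $$ (r, c)) = johnson_E (2 * d) d j 0" if "c < N" for c
    using sum_pair_sign_M[of "[]" c] that by simp
  note spec = spectrum_mset_const_col_sum[OF M_carrier N_pos col]
  show "johnson_E (2 * d) d j 0 \<in># spectrum_mset M" by (rule spec(1))
  assume "z \<in># spectrum_mset M - {#johnson_E (2 * d) d j 0#}"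
  from spec(2)[OF _ this] show "\<exists>i. 1 \<le> i \<and> i \<le> d \<and> z = johnson_E (2 * d) d j i"
    using eigenvector_eigenvalue by blast
qed

lemma eigenvalue_iff_spectrum: "eigenvalue M z \<longleftrightarrow> z \<in># spectrum_mset M"
proof -
  have "char_poly M \<noteq> 0" using degree_monic_char_poly[OF M_carrier] by auto
  then show ?thesis by (simp add: spectrum_mset_def eigenvalue_root_char_poly[OF M_carrier])
qed

text \<open>The signs of \<open>[(a, b)]\<close> are nonzero at a \<open>d\<close>-subset containing
  \<open>a\<close> but not \<open>b\<close>. Besides the valency, only this eigenvalue must be shown
  to occur; the others are only bounded.\<close>

lemma eigenvalue_johnson_E_1:
  assumes "0 < d"
  shows "eigenvalue M (johnson_E (2 * d) d j 1)"
proof -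
  obtain Y where "Y \<subseteq> X" "card Y = 2"
    using obtain_subset_with_card_n[of 2 X] card_X assms by auto
  then obtain a b where ab: "a \<in> X" "b \<in> X" "a \<noteq> b" by (auto simp: card_2_iff)
  have "card (X - {a, b}) = 2 * d - 2"
    using ab fin card_X by (simp add: card_Diff_subset)
  then obtain C where C: "C \<subseteq> X - {a, b}" "card C = d - 1" "finite C"
    using obtain_subset_with_card_n[of "d - 1" "X - {a, b}"] assms fin
    by (metis le_add2 mult_2 diff_mult_distrib2 mult_1_right)
  then have "insert a C \<in> ksubsets X d" "pair_sign [(a, b)] (insert a C) \<noteq> 0"
    using ab assms by (auto simp: ksubsets_def card_insert_if)
  then show ?thesis
    using eigenvalue_johnson_E[of "[(a, b)]"] ab by simp
qed

end

section \<open>Extremal eigenvalues for \<open>d < 2 * j\<close>\<close>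

theorem corollary3p11:
  fixes d j :: nat and X :: "'a set" and vs :: "'a set list"
  assumes "d \<ge> 1"
    and "real d / 2 < real j" and "j \<le> d"
    and "finite X" and "card X = 2 * d"
    and "distinct vs" and "set vs = pverts (johnson_graph X d j)"
  shows "smallest_eigenvalue (adjacency_matrix (johnson_graph X d j) vs) (johnson_E (2 * d) d j 1)
    \<and> second_largest_abs_eigenvalue (adjacency_matrix (johnson_graph X d j) vs) (johnson_E (2 * d) d j 1)
    \<and> (\<forall>i. 0 \<le> i \<and> i \<le> d \<longrightarrow> johnson_E (2 * d) d j 1 \<le> johnson_E (2 * d) d j i)
    \<and> (\<forall>i. 1 \<le> i \<and> i \<le> d \<longrightarrow> \<bar>johnson_E (2 * d) d j i\<bar> \<le> \<bar>johnson_E (2 * d) d j 1\<bar>)"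
proof -
  interpret johnson_enum d j X vs
    using assms by unfold_locales (simp_all add: pverts_johnson_graph)
  let ?E = "johnson_E (2 * d) d j"
  have j: "d < 2 * j" using assms(2) by linarith
  then have pos: "0 < eberlein_bound d j"
    using assms(1,3) by (simp add: eberlein_bound_def)
  obtain m j' where mj: "d = Suc m" "j = Suc j'"
    using assms(1) j by (metis Suc_le_D One_nat_def gr0_implies_Suc mult_0_right not_less_zero neq0_conv)
  have E1: "?E 1 = - eberlein_bound d j"
    using eberlein_one[of m j'] johnson_E_eq_eberlein[OF assms(1)] by (simp add: mj)
  have E0: "?E 0 = (real (d choose j))\<^sup>2"
    by (simp add: johnson_E_eq_eberlein)
  have E0_ge: "eberlein_bound d j \<le> ?E 0"
    unfolding E0 using assms(1,3) by (intro eberlein_bound_le) auto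
  have abs_le: "\<bar>?E i\<bar> \<le> eberlein_bound d j" if "1 \<le> i" "i \<le> d" for i
    using abs_eberlein_le[of i "d - i" j] that j by (simp add: johnson_E_eq_eberlein)
  \<comment> \<open>The index \<open>i = 0\<close> is outside \<open>abs_le\<close>, but
    \<open>E_j(0)\<close> is positive and \<open>E_j(1)\<close> negative.\<close>
  have E_min: "?E 1 \<le> ?E i" if "i \<le> d" for i
    using abs_le[of i] that E1 E0_ge pos by (cases "i = 0") auto
  have E_second: "1 \<le> i \<and> i \<le> d \<longrightarrow> \<bar>?E i\<bar> \<le> \<bar>?E 1\<bar>" for i
    using abs_le[of i] E1 pos by auto
  have spec_cases: "z = ?E 0 \<or> z \<in># spectrum_mset M - {#?E 0#}" if "z \<in># spectrum_mset M" for z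
    using that by (cases "z = ?E 0") (simp_all add: in_diff_count)
  have spec: "\<exists>i\<le>d. z = ?E i" if "z \<in># spectrum_mset M" for z
    using spec_cases[OF that] spectrum_johnson(2) by blast
  have E1_spec: "?E 1 \<in># spectrum_mset M"
    using eigenvalue_johnson_E_1 assms(1) by (simp add: eigenvalue_iff_spectrum)
  have "smallest_eigenvalue M (?E 1)"
    unfolding smallest_eigenvalue_def eigenvalue_iff_spectrum
    using E1_spec spec E_min by blast
  \<comment> \<open>The first place goes to the valency \<open>E_j(0)\<close>.\<close>
  moreover have "second_largest_abs_eigenvalue M (?E 1)"
    unfolding second_largest_abs_eigenvalue_def
  proof (intro exI[of _ "?E 0"] conjI allI impI)
    show "?E 0 \<in># spectrum_mset M" by (rule spectrum_johnson(1))
    show "\<bar>z\<bar> \<le> \<bar>?E 0\<bar>" if z: "z \<in># spectrum_mset M" for z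
    proof -
      obtain i where "i \<le> d" "z = ?E i" using spec[OF z] by blast
      then show ?thesis using abs_le[of i] E0_ge pos by (cases "i = 0") auto
    qed
    \<comment> \<open>Having opposite signs, \<open>E_j(1)\<close> and \<open>E_j(0)\<close> differ,
      so removing a copy of the latter keeps the former.\<close>
    show "?E 1 \<in># spectrum_mset M - {#?E 0#}"
      using E1_spec spec_cases E1 E0_ge pos by fastforce
    show "\<bar>z\<bar> \<le> \<bar>?E 1\<bar>" if "z \<in># spectrum_mset M - {#?E 0#}" for z
      using spectrum_johnson(2)[OF that] E_second by blast
  qed
  ultimately show ?thesis using E_min E_second by blast
qed

end
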